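(* Let $\beta \geq 1$ be a real number. Then for every integer $k\ge 0$, $10\,0^k\,01 \geq_\beta 01\,0^k\,10$, where juxtaposition denotes concatenation of bit strings and $0^k$ is the string of $k$ zeros.
   Context: Let $\beta$ be a positive real number. The beta expansion of a bit string $\alpha=a_1\cdots a_\ell\in\{0,1\}^\ell$ is $\alpha_\beta=\sum_{i=1}^{\ell}a_i\beta^{\ell-i}$. For bit strings $\alpha,\gamma$, write $\alpha\ge_\beta\gamma$ if $\alpha_\beta\ge\gamma_\beta$. *)

theory Defs
  imports Complex_Main
begin

(* Bit strings are lists of booleans: True is the bit 1, False is the bit 0, and the
   head of the list is the leftmost bit. *)
type_synonym bitstring = "bool list"

(* The i-th bit, counted from 1, is the list element at index i - 1.  Both natural-number
   subtractions are exact on the range of summation. *)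
definition beta_expansion :: "real \<Rightarrow> bitstring \<Rightarrow> real" where
  "beta_expansion \<beta> \<alpha> =
     (\<Sum>i = 1..length \<alpha>. of_bool (\<alpha> ! (i - 1)) * \<beta> ^ (length \<alpha> - i))"

definition beta_ge :: "real \<Rightarrow> bitstring \<Rightarrow> bitstring \<Rightarrow> bool" where
  "beta_ge \<beta> \<alpha> \<gamma> \<longleftrightarrow> beta_expansion \<beta> \<alpha> \<ge> beta_expansion \<beta> \<gamma>"

end

theory Submission
  imports Defs
begin

text \<open>The two expansions are \<beta>^(k+3) + 1 and \<beta>^(k+2) + \<beta>. Their difference
  factors as (\<beta> - 1) * (\<beta>^(k+2) - 1), and both factors are nonnegative for \<beta> \<ge>
  1.\<close>

lemma beta_expansion_Nil: "beta_expansion \<beta> [] = 0"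
  by (simp add: beta_expansion_def)

text \<open>Weights count from the right end, so a new leading bit leaves the others unchanged. This
  recursion lets the simplifier evaluate concrete strings.\<close>

lemma beta_expansion_Cons:
  "beta_expansion \<beta> (a # \<alpha>) = of_bool a * \<beta> ^ length \<alpha> + beta_expansion \<beta> \<alpha>"
proof -
  have "beta_expansion \<beta> (a # \<alpha>) = of_bool a * \<beta> ^ length \<alpha> +
      (\<Sum>i = 1..length \<alpha>. of_bool ((a # \<alpha>) ! i) * \<beta> ^ (length \<alpha> - i))"
    unfolding beta_expansion_def
    \<comment> \<open>The deleted rules would split off the last term instead of the first, or
      absorb the bits into the index set.\<close>
    by (simp add: sum.shift_bounds_cl_Suc_ivl sum.atLeast_Suc_atMost[of 0]
        del: sum.cl_ivl_Suc sum_of_bool_mult_eq sum_mult_of_bool_eq)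
  also have "(\<Sum>i = 1..length \<alpha>. of_bool ((a # \<alpha>) ! i) * \<beta> ^ (length \<alpha> - i)) =
      beta_expansion \<beta> \<alpha>"
    unfolding beta_expansion_def by (rule sum.cong) (auto simp: nth_Cons')
  finally show ?thesis .
qed

text \<open>Leading zeros add nothing. The block 0^k becomes leading once the two bits before it are
  peeled off.\<close>

lemma beta_expansion_replicate_False_append:
  "beta_expansion \<beta> (replicate k False @ \<alpha>) = beta_expansion \<beta> \<alpha>"
  by (induction k) (simp_all add: beta_expansion_Cons)

theorem proposition34:
  fixes \<beta> :: real and k :: nat
  assumes "\<beta> \<ge> 1"
  shows "beta_ge \<beta>
           ([True, False] @ replicate k False @ [False, True])
           ([False, True] @ replicate k False @ [True, False])"
proof -
  have "0 \<le> (\<beta> - 1) * (\<beta> ^ (k + 2) - 1)"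
    \<comment> \<open>Unfolding the power into a product would hide it from
      \<open>one_le_power\<close>.\<close>
    using assms by (intro mult_nonneg_nonneg) (simp_all add: one_le_power del: power_Suc)
  then have "\<beta> ^ (k + 2) + \<beta> \<le> \<beta> ^ (k + 3) + 1"
    by (simp add: algebra_simps eval_nat_numeral)
  then show ?thesis
    by (simp add: beta_ge_def beta_expansion_Cons beta_expansion_Nil
        beta_expansion_replicate_False_append eval_nat_numeral)
qed

end
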